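(* Let $n$ be a positive integer and let $S$ and $T$ be fb-tableaux of size $n$. Then $S\lhd T$ is a cover relation in $\operatorname{esTam}_n$ (i.e. $S\ne T$, $S\lhd T$, and no fb-tableau lies strictly between them) if and only if $T$ is obtained from $S$ by a move of type I, a move of type II, or a move of type III.
   Context: Let $n$ be a positive integer. The board of size $n$ is the Ferrers diagram of shape $(n,n,n-1,n-2,\dots,3,2)$ (a single cell $(1,1)$ if $n=1$). Its cells are written $(i,j)$, where $i$ is the row, numbered from the top, and $j$ is the column label, the columns being labelled $n,n-1,\dots,1$ from left to right. So the cells are $(1,j)$ for $1\le j\le n$ and $(i,j)$ for $2\le i\le n$, $i-1\le j\le n$. The root is $(1,n)$ (top-left cell); the border cells are $(i,i-1)$ for $2\le i\le n$ (the rightmost cells of rows $2,\dots,n$). An fb-tableau of size $n$ is a filling in which each cell is either empty or nonempty such that the root and all border cells are nonempty, and every nonempty cell other than the root has a nonempty cell strictly to its left in the same row or strictly above it in the same column. In an fb-tableau, a nonempty cell different from the root is called a left-arrow if there is no nonempty cell strictly to its left in its row, an up-arrow if there is no nonempty cell strictly above it in its column, and a dot otherwise; the root is also a dot. (Each of rows $2,\dots,n$ has exactly one left-arrow, each of columns $1,\dots,n-1$ has exactly one up-arrow.) A cell is free in $T$ if it lies strictly below an up-arrow (same column) and strictly to the right of a left-arrow (same row); a free cell is either empty or contains a dot. $\operatorname{Row}(T)$ is the set of cells lying weakly to the right of a left-arrow or of the root in the same row; $\operatorname{Col}(T)$ is the set of cells lying weakly below an up-arrow or the root in the same column. For fb-tableaux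 $S,T$ of size $n$, write $S\lhd T$ if (1) $\operatorname{Col}(S)\subseteq\operatorname{Col}(T)$; (2) $\operatorname{Row}(T)\subseteq\operatorname{Row}(S)$; (3) for every cell $c$ that is free in both $S$ and $T$, if $c$ contains a dot in $S$ then $c$ contains a dot in $T$. The extra slow Tamari lattice $\operatorname{esTam}_n$ is the set of fb-tableaux of size $n$ ordered by $\lhd$. A cell is pointed by a left-arrow if it lies strictly to the left of the left-arrow of its row. Moves on an fb-tableau $S$ (all cells not mentioned keep their content): Type I: choose an up-arrow of $S$ above which there is a cell (in its column) not pointed by a left-arrow; move this up-arrow to the closest cell above it that is not pointed by a left-arrow. The cell it leaves (which becomes free) is filled with a dot if it is a border cell and is left empty otherwise. Type II: choose a left-arrow of $S$ such that the first free cell to its right (in its row) contains a dot; move the left-arrow to this closest free cell to its right (replacing the dot), leaving its old cell empty. Type III: choose an empty free cell of $S$ and insert a dot in it. *)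

theory Defs
  imports Main
begin

text \<open>
  A cell is a pair \<open>(i, j)\<close> of a row number \<open>i\<close> (counted from the top) and a column label \<open>j\<close>.
  Column labels \<^emph>\<open>decrease\<close> from left to right, so a cell is further to the left if its column label
  is larger.
\<close>

type_synonym cell = "nat \<times> nat"

definition board :: "nat \<Rightarrow> cell set" where
  "board n = {(1, j) | j. 1 \<le> j \<and> j \<le> n} \<union> {(i, j) | i j. 2 \<le> i \<and> i \<le> n \<and> i - 1 \<le> j \<and> j \<le> n}"

definition root :: "nat \<Rightarrow> cell" where
  "root n = (1, n)"

definition border :: "nat \<Rightarrow> cell set" where
  "border n = {(i, i - 1) | i. 2 \<le> i \<and> i \<le> n}"

definition left_of :: "cell \<Rightarrow> cell \<Rightarrow> bool" where
  "left_of c d \<longleftrightarrow> fst c = fst d \<and> snd d < snd c"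

definition above :: "cell \<Rightarrow> cell \<Rightarrow> bool" where
  "above c d \<longleftrightarrow> snd c = snd d \<and> fst c < fst d"

text \<open>A filling is represented by its set of nonempty cells.\<close>

definition fb_tableau :: "nat \<Rightarrow> cell set \<Rightarrow> bool" where
  "fb_tableau n T \<longleftrightarrow>
     T \<subseteq> board n \<and> root n \<in> T \<and> border n \<subseteq> T \<and>
     (\<forall>c\<in>T. c \<noteq> root n \<longrightarrow> (\<exists>d\<in>T. left_of d c \<or> above d c))"

datatype content = Empty | Left_Arrow | Up_Arrow | Dot

text \<open>
  In an fb-tableau the left-arrow and up-arrow cases are mutually exclusive, so the order of the
  tests below is irrelevant.
\<close>

definition content :: "nat \<Rightarrow> cell set \<Rightarrow> cell \<Rightarrow> content" where
  "content n T c =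
     (if c \<notin> T then Empty
      else if c = root n then Dot
      else if \<not> (\<exists>d\<in>T. left_of d c) then Left_Arrow
      else if \<not> (\<exists>d\<in>T. above d c) then Up_Arrow
      else Dot)"

definition free_cells :: "nat \<Rightarrow> cell set \<Rightarrow> cell set" where
  "free_cells n T = {c \<in> board n.
     (\<exists>u. content n T u = Up_Arrow \<and> above u c) \<and>
     (\<exists>l. content n T l = Left_Arrow \<and> left_of l c)}"

definition Row_cells :: "nat \<Rightarrow> cell set \<Rightarrow> cell set" where
  "Row_cells n T = {c \<in> board n.
     \<exists>d. (content n T d = Left_Arrow \<or> d = root n) \<and> (d = c \<or> left_of d c)}"

definition Col_cells :: "nat \<Rightarrow> cell set \<Rightarrow> cell set" where
  "Col_cells n T = {c \<in> board n.
     \<exists>d. (content n T d = Up_Arrow \<or> d = root n) \<and> (d = c \<or> above d c)}"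

definition es_le :: "nat \<Rightarrow> cell set \<Rightarrow> cell set \<Rightarrow> bool" where
  "es_le n S T \<longleftrightarrow>
     Col_cells n S \<subseteq> Col_cells n T \<and>
     Row_cells n T \<subseteq> Row_cells n S \<and>
     (\<forall>c \<in> free_cells n S \<inter> free_cells n T. content n S c = Dot \<longrightarrow> content n T c = Dot)"

definition es_covers :: "nat \<Rightarrow> cell set \<Rightarrow> cell set \<Rightarrow> bool" where
  "es_covers n S T \<longleftrightarrow>
     S \<noteq> T \<and> es_le n S T \<and>
     \<not> (\<exists>U. fb_tableau n U \<and> U \<noteq> S \<and> U \<noteq> T \<and> es_le n S U \<and> es_le n U T)"

definition pointed :: "nat \<Rightarrow> cell set \<Rightarrow> cell set" where
  "pointed n T = {c \<in> board n. \<exists>l. content n T l = Left_Arrow \<and> left_of c l}"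

text \<open>
  A move is expressed as an update of the content function: the cells mentioned by the move get their
  new contents, and every other cell keeps its content.
\<close>

definition move_I :: "nat \<Rightarrow> cell set \<Rightarrow> cell set \<Rightarrow> bool" where
  "move_I n S T \<longleftrightarrow>
     (\<exists>u c. content n S u = Up_Arrow \<and>
        c \<in> board n \<and> above c u \<and> c \<notin> pointed n S \<and>
        (\<forall>d \<in> board n. above c d \<and> above d u \<longrightarrow> d \<in> pointed n S) \<and>
        content n T = (content n S)(c := Up_Arrow, u := (if u \<in> border n then Dot else Empty)))"

definition move_II :: "nat \<Rightarrow> cell set \<Rightarrow> cell set \<Rightarrow> bool" where
  "move_II n S T \<longleftrightarrow>
     (\<exists>l c. content n S l = Left_Arrow \<and>
        c \<in> free_cells n S \<and> left_of l c \<and>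
        (\<forall>d \<in> free_cells n S. \<not> (left_of l d \<and> left_of d c)) \<and>
        content n S c = Dot \<and>
        content n T = (content n S)(c := Left_Arrow, l := Empty))"

definition move_III :: "nat \<Rightarrow> cell set \<Rightarrow> cell set \<Rightarrow> bool" where
  "move_III n S T \<longleftrightarrow>
     (\<exists>c \<in> free_cells n S. content n S c = Empty \<and> content n T = (content n S)(c := Dot))"

end

theory Submission
  imports Defs
begin

text \<open>
  An fb-tableau is determined by the column of the leftmost nonempty cell of each row, the row of
  the topmost nonempty cell of each column, and the dots in its free cells. In these coordinates
  \<open>\<lhd>\<close> says that the former two functions decrease and that dots survive where the cell stays free.
  If \<open>S \<lhd> T\<close> and \<open>S \<noteq> T\<close>, then some move leads from \<open>S\<close> to a tableau weakly below \<open>T\<close>: raise an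
  up-arrow as long as the up-arrows differ; once they agree, push a left-arrow to the right (or
  first insert the dot that it has to replace); once all arrows agree, insert a dot. Trying the
  up-arrows first matters, since a left-arrow must not jump over an up-arrow of its row.
  Conversely a move changes a single coordinate by the least amount that the tableau conditions allow.
\<close>

section \<open>Extreme cells of rows and columns\<close>

text \<open>Column labels decrease from left to right, hence \<open>GREATEST\<close> for the
  leftmost cell. Outside the rows \<open>1..n\<close> of a tableau the value is unspecified, which
  explains the row bounds in many statements below.\<close>

definition leftmost :: "cell set \<Rightarrow> nat \<Rightarrow> nat" where
  "leftmost T i = (GREATEST j. (i, j) \<in> T)"

definition topmost :: "cell set \<Rightarrow> nat \<Rightarrow> nat" where
  "topmost T j = (LEAST i. (i, j) \<in> T)"

lemma board_iff: "(i, j) \<in> board n \<longleftrightarrow> 1 \<le> i \<and> i \<le> n \<and> 1 \<le> j \<and> j \<le> n \<and> i \<le> j + 1"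
  unfolding board_def by auto

lemma border_iff: "(i, j) \<in> border n \<longleftrightarrow> 2 \<le> i \<and> i \<le> n \<and> i = j + 1"
  unfolding border_def by auto

lemma fb_boardD:
  assumes "fb_tableau n T" "(i, j) \<in> T"
  shows "1 \<le> i" "i \<le> n" "1 \<le> j" "j \<le> n" "i \<le> j + 1"
proof -
  have "(i, j) \<in> board n" using assms unfolding fb_tableau_def by blast
  then show "1 \<le> i" "i \<le> n" "1 \<le> j" "j \<le> n" "i \<le> j + 1"
    by (auto simp: board_iff)
qed

lemma fb_root: "fb_tableau n T \<Longrightarrow> (1, n) \<in> T"
  unfolding fb_tableau_def root_def by simp

lemma fb_border: "fb_tableau n T \<Longrightarrow> 2 \<le> i \<Longrightarrow> i \<le> n \<Longrightarrow> i = j + 1 \<Longrightarrow> (i, j) \<in> T"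
  unfolding fb_tableau_def using border_iff[of i j n] by blast

lemma leftmost_mem:
  assumes "fb_tableau n T" "1 \<le> i" "i \<le> n"
  shows "(i, leftmost T i) \<in> T"
proof -
  have "\<exists>j. (i, j) \<in> T"
  proof (cases "i = 1")
    case False
    then have "(i, i - 1) \<in> T" using assms by (intro fb_border) auto
    then show ?thesis ..
  qed (use fb_root[OF assms(1)] in blast)
  then show ?thesis
    unfolding leftmost_def using GreatestI_ex_nat[of "\<lambda>j. (i, j) \<in> T" n] fb_boardD(4)[OF assms(1)]
    by blast
qed

lemma le_leftmost:
  assumes "fb_tableau n T" "(i, j) \<in> T"
  shows "j \<le> leftmost T i"
  unfolding leftmost_def
  using Greatest_le_nat[of "\<lambda>j. (i, j) \<in> T" j n] fb_boardD(4)[OF assms(1)] assms(2) by blast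

lemma leftmost_eqI:
  assumes "(i, j) \<in> T" "\<And>k. (i, k) \<in> T \<Longrightarrow> k \<le> j"
  shows "leftmost T i = j"
  unfolding leftmost_def using assms by (intro Greatest_equality) auto

lemma topmost_mem:
  assumes "fb_tableau n T" "1 \<le> j" "j \<le> n"
  shows "(topmost T j, j) \<in> T"
proof -
  have "\<exists>i. (i, j) \<in> T"
  proof (cases "j = n")
    case False
    then have "(j + 1, j) \<in> T" using assms by (intro fb_border) auto
    then show ?thesis ..
  qed (use fb_root[OF assms(1)] in blast)
  then show ?thesis unfolding topmost_def by (rule LeastI_ex)
qed

lemma topmost_le: "(i, j) \<in> T \<Longrightarrow> topmost T j \<le> i"
  unfolding topmost_def by (rule Least_le)

lemma topmost_eqI:
  assumes "(i, j) \<in> T" "\<And>k. (k, j) \<in> T \<Longrightarrow> i \<le> k"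
  shows "topmost T j = i"
  unfolding topmost_def using assms by (intro Least_equality) auto

lemma leftmost_1: "fb_tableau n T \<Longrightarrow> leftmost T 1 = n"
  using fb_root fb_boardD(4) by (intro leftmost_eqI) auto

lemma topmost_n: "fb_tableau n T \<Longrightarrow> topmost T n = 1"
  using fb_root fb_boardD(1) by (intro topmost_eqI) auto

lemma leftmost_bounds:
  assumes "fb_tableau n T" "1 \<le> i" "i \<le> n"
  shows "leftmost T i \<le> n" "1 \<le> leftmost T i" "i \<le> leftmost T i + 1"
  using fb_boardD[OF assms(1) leftmost_mem[OF assms]] by auto

lemma topmost_bounds:
  assumes "fb_tableau n T" "1 \<le> j" "j \<le> n"
  shows "topmost T j \<le> n" "1 \<le> topmost T j" "topmost T j \<le> j + 1"
  using fb_boardD[OF assms(1) topmost_mem[OF assms]] by auto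

text \<open>The supporting cell demanded by \<open>fb_tableau\<close> bounds the extreme cell of its
  row or column. So only the root is both leftmost in its row and topmost in its column.\<close>

lemma fb_supported:
  assumes T: "fb_tableau n T" and ij: "(i, j) \<in> T" "(i, j) \<noteq> (1, n)"
  shows "j < leftmost T i \<or> topmost T j < i"
proof -
  obtain d where "d \<in> T" "left_of d (i, j) \<or> above d (i, j)"
    using T ij unfolding fb_tableau_def root_def by blast
  then show ?thesis
    using le_leftmost[OF T] topmost_le[of _ _ T] unfolding left_of_def above_def
    by (cases d) (force intro: less_le_trans le_less_trans)
qed

text \<open>Nothing lies to the left of a left-arrow, so its support comes from above; dually, in
  \<open>leftmost_topmost\<close>, an up-arrow is supported from the left. These two facts later
  exclude impossible arrow positions in intermediate tableaux.\<close>

lemma topmost_leftmost: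
  assumes "fb_tableau n T" "2 \<le> i" "i \<le> n"
  shows "topmost T (leftmost T i) < i"
  using fb_supported[OF assms(1) leftmost_mem[of n T i]] assms by auto

lemma leftmost_topmost:
  assumes "fb_tableau n T" "1 \<le> j" "j < n"
  shows "j < leftmost T (topmost T j)"
  using fb_supported[OF assms(1) topmost_mem[of n T j]] assms by auto

lemma fb_tableauI:
  assumes "T \<subseteq> board n" "(1, n) \<in> T" "\<And>i. 2 \<le> i \<Longrightarrow> i \<le> n \<Longrightarrow> (i, i - 1) \<in> T"
    and "\<And>i j. (i, j) \<in> T \<Longrightarrow> (i, j) \<noteq> (1, n) \<Longrightarrow>
           (\<exists>k>j. (i, k) \<in> T) \<or> (\<exists>k<i. (k, j) \<in> T)"
  shows "fb_tableau n T"
proof -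
  have "\<exists>d\<in>T. left_of d c \<or> above d c" if "c \<in> T" "c \<noteq> root n" for c
    using assms(4)[of "fst c" "snd c"] that
    unfolding left_of_def above_def root_def
    by (metis fst_conv snd_conv prod.collapse)
  then show ?thesis
    unfolding fb_tableau_def root_def border_def using assms(1-3) by (auto simp: root_def)
qed

section \<open>Contents, arrows and free cells in coordinates\<close>

lemma exists_left_of:
  assumes "fb_tableau n T" "(i, j) \<in> T"
  shows "(\<exists>d\<in>T. left_of d (i, j)) \<longleftrightarrow> j < leftmost T i"
proof
  assume "\<exists>d\<in>T. left_of d (i, j)"
  then show "j < leftmost T i"
    using le_leftmost[OF assms(1)] unfolding left_of_def by (force intro: less_le_trans)
next
  assume "j < leftmost T i"
  then show "\<exists>d\<in>T. left_of d (i, j)"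
    using leftmost_mem[OF assms(1)] fb_boardD[OF assms] unfolding left_of_def by force
qed

lemma exists_above:
  assumes "fb_tableau n T" "(i, j) \<in> T"
  shows "(\<exists>d\<in>T. above d (i, j)) \<longleftrightarrow> topmost T j < i"
proof
  assume "\<exists>d\<in>T. above d (i, j)"
  then show "topmost T j < i"
    using topmost_le unfolding above_def by (force intro: le_less_trans)
next
  assume "topmost T j < i"
  then show "\<exists>d\<in>T. above d (i, j)"
    using topmost_mem[OF assms(1)] fb_boardD[OF assms] unfolding above_def by force
qed

lemma content_eq:
  assumes "fb_tableau n T"
  shows "content n T (i, j) =
    (if (i, j) \<notin> T then Empty
     else if (i, j) = (1, n) then Dot
     else if j = leftmost T i then Left_Arrow
     else if i = topmost T j then Up_Arrow
     else Dot)"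
proof (cases "(i, j) \<in> T")
  case True
  have "j = leftmost T i \<longleftrightarrow> \<not> (\<exists>d\<in>T. left_of d (i, j))"
    using exists_left_of[OF assms True] le_leftmost[OF assms True] by linarith
  moreover have "i = topmost T j \<longleftrightarrow> \<not> (\<exists>d\<in>T. above d (i, j))"
    using exists_above[OF assms True] topmost_le[OF True] by linarith
  ultimately show ?thesis
    using True unfolding content_def root_def by presburger
qed (simp add: content_def)

text \<open>The leftmost cell of row 1 is the root, which counts as a dot; hence the bound
  \<open>2 \<le> i\<close>.\<close>

lemma left_arrow_iff:
  assumes "fb_tableau n T"
  shows "content n T (i, j) = Left_Arrow \<longleftrightarrow> 2 \<le> i \<and> i \<le> n \<and> j = leftmost T i"
proof (cases "(i, j) \<in> T")
  case True
  then have "2 \<le> i \<or> i = 1" using fb_boardD(1)[OF assms] by fastforce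
  moreover have "topmost T j < i \<or> (i, j) = (1, n)" if "j = leftmost T i"
    using fb_supported[OF assms True] that by auto
  ultimately show ?thesis
    using True content_eq[OF assms, of i j] leftmost_1[OF assms] fb_boardD(2)[OF assms True]
    by auto
qed (use content_eq[OF assms, of i j] leftmost_mem[OF assms, of i] in auto)

lemma up_arrow_iff:
  assumes "fb_tableau n T"
  shows "content n T (i, j) = Up_Arrow \<longleftrightarrow> 1 \<le> j \<and> j < n \<and> i = topmost T j"
proof (cases "(i, j) \<in> T")
  case True
  then have "j < n \<or> j = n" using fb_boardD(4)[OF assms] by fastforce
  then show ?thesis
    using True content_eq[OF assms, of i j] topmost_n[OF assms] fb_boardD(3)[OF assms True]
      leftmost_topmost[OF assms, of j]
    by auto
qed (use content_eq[OF assms, of i j] topmost_mem[OF assms, of j] in auto)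

text \<open>On the board the two inequalities force \<open>2 \<le> i\<close> and
  \<open>j < n\<close>, so row \<open>i\<close> and column \<open>j\<close> really start with arrows
  and not with the root.\<close>

lemma free_iff:
  assumes T: "fb_tableau n T"
  shows "(i, j) \<in> free_cells n T \<longleftrightarrow> (i, j) \<in> board n \<and> topmost T j < i \<and> j < leftmost T i"
proof -
  have "j < n" if "(i, j) \<in> board n" "j < leftmost T i"
    using that leftmost_bounds(1)[OF T, of i] by (auto simp: board_iff)
  moreover have "2 \<le> i" if "(i, j) \<in> board n" "topmost T j < i"
    using that topmost_bounds(2)[OF T, of j] by (auto simp: board_iff)
  ultimately show ?thesis
    unfolding free_cells_def above_def left_of_def
    by (auto simp: left_arrow_iff[OF T] up_arrow_iff[OF T] board_iff)
qed

lemma dot_iff: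
  assumes "fb_tableau n T" "topmost T j < i" "j < leftmost T i"
  shows "content n T (i, j) = Dot \<longleftrightarrow> (i, j) \<in> T"
  using assms content_eq[OF assms(1), of i j] by auto

lemma pointed_iff:
  assumes T: "fb_tableau n T"
  shows "(i, j) \<in> pointed n T \<longleftrightarrow> (i, j) \<in> board n \<and> leftmost T i < j"
proof -
  have "2 \<le> i" if "(i, j) \<in> board n" "leftmost T i < j"
  proof -
    have "i \<noteq> 1" using that leftmost_1[OF T] by (auto simp: board_iff)
    then show ?thesis using that by (auto simp: board_iff)
  qed
  then show ?thesis
    unfolding pointed_def left_of_def by (auto simp: left_arrow_iff[OF T] board_iff)
qed

section \<open>The order in coordinates\<close>

lemma Row_iff:
  assumes T: "fb_tableau n T"
  shows "(i, j) \<in> Row_cells n T \<longleftrightarrow> (i, j) \<in> board n \<and> j \<le> leftmost T i"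
proof -
  have "(i, j) \<in> Row_cells n T \<longleftrightarrow> (i, j) \<in> board n \<and>
      (\<exists>k. (2 \<le> i \<and> i \<le> n \<and> k = leftmost T i \<or> i = 1 \<and> k = n) \<and> j \<le> k)"
    unfolding Row_cells_def left_of_def root_def
    by (auto simp: left_arrow_iff[OF T] le_less)
  then show ?thesis
    using leftmost_1[OF T] by (cases "i = 1") (auto simp: board_iff)
qed

lemma Col_iff:
  assumes T: "fb_tableau n T"
  shows "(i, j) \<in> Col_cells n T \<longleftrightarrow> (i, j) \<in> board n \<and> topmost T j \<le> i"
proof -
  have "(i, j) \<in> Col_cells n T \<longleftrightarrow> (i, j) \<in> board n \<and>
      (\<exists>k. (1 \<le> j \<and> j < n \<and> k = topmost T j \<or> j = n \<and> k = 1) \<and> k \<le> i)"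
    unfolding Col_cells_def above_def root_def
    by (auto simp: up_arrow_iff[OF T] le_less)
  then show ?thesis
    using topmost_n[OF T] by (cases "j = n") (auto simp: board_iff)
qed

text \<open>The inclusions of the Row and Col sets are tested at the extreme cells, which gives the
  two monotonicity clauses. Under these, \<open>topmost T j \<le> topmost S j < i\<close> and
  \<open>j < leftmost T i \<le> leftmost S i\<close>, so the two inequalities of the last clause
  already make the cell free in both tableaux.\<close>

lemma es_le_iff:
  assumes S: "fb_tableau n S" and T: "fb_tableau n T"
  shows "es_le n S T \<longleftrightarrow>
    (\<forall>j. 1 \<le> j \<and> j \<le> n \<longrightarrow> topmost T j \<le> topmost S j) \<and>
    (\<forall>i. 1 \<le> i \<and> i \<le> n \<longrightarrow> leftmost T i \<le> leftmost S i) \<and>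
    (\<forall>i j. (i, j) \<in> S \<and> topmost S j < i \<and> j < leftmost T i \<longrightarrow> (i, j) \<in> T)"
    (is "_ \<longleftrightarrow> ?C \<and> ?R \<and> ?D")
proof -
  have C: "Col_cells n S \<subseteq> Col_cells n T \<longleftrightarrow> ?C"
  proof
    assume L: "Col_cells n S \<subseteq> Col_cells n T"
    show ?C
    proof safe
      fix j assume "1 \<le> j" "j \<le> n"
      then have "(topmost S j, j) \<in> Col_cells n S"
        using topmost_bounds[OF S] by (auto simp: Col_iff[OF S] board_iff)
      then show "topmost T j \<le> topmost S j" using L by (auto simp: Col_iff[OF T])
    qed
  next
    assume ?C
    then show "Col_cells n S \<subseteq> Col_cells n T"
      by (fastforce simp: Col_iff[OF S] Col_iff[OF T] board_iff)
  qed
  have R: "Row_cells n T \<subseteq> Row_cells n S \<longleftrightarrow> ?R"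
  proof
    assume L: "Row_cells n T \<subseteq> Row_cells n S"
    show ?R
    proof safe
      fix i assume "1 \<le> i" "i \<le> n"
      then have "(i, leftmost T i) \<in> Row_cells n T"
        using leftmost_bounds[OF T] by (auto simp: Row_iff[OF T] board_iff)
      then show "leftmost T i \<le> leftmost S i" using L by (auto simp: Row_iff[OF S])
    qed
  next
    assume ?R
    then show "Row_cells n T \<subseteq> Row_cells n S"
      by (fastforce simp: Row_iff[OF S] Row_iff[OF T] board_iff)
  qed
  have D: "(\<forall>c \<in> free_cells n S \<inter> free_cells n T. content n S c = Dot \<longrightarrow> content n T c = Dot)
      \<longleftrightarrow> ?D" (is "?L \<longleftrightarrow> _") if ?C ?R
  proof -
    have *: "(i, j) \<in> free_cells n S \<inter> free_cells n T" if "(i, j) \<in> S" "topmost S j < i" "j < leftmost T i" for i j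
    proof -
      note ij = fb_boardD[OF S that(1)]
      have "topmost T j \<le> topmost S j" "leftmost T i \<le> leftmost S i"
        using \<open>?C\<close> \<open>?R\<close> ij by blast+
      then show ?thesis
        using that ij by (simp add: free_iff[OF S] free_iff[OF T] board_iff)
    qed
    \<comment> \<open>On free cells, containing a dot means being nonempty; the congruence rules
      supply freeness to \<open>dot_iff\<close>.\<close>
    have "(\<forall>c \<in> free_cells n S \<inter> free_cells n T. content n S c = Dot \<longrightarrow> content n T c = Dot)
      \<longleftrightarrow> (\<forall>i j. (i, j) \<in> free_cells n S \<inter> free_cells n T \<longrightarrow> (i, j) \<in> S \<longrightarrow> (i, j) \<in> T)"
      by (simp add: split_paired_All Ball_def free_iff[OF S] free_iff[OF T]
          dot_iff[OF S] dot_iff[OF T] cong: imp_cong conj_cong)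
    also have "\<dots> \<longleftrightarrow> ?D"
      using * by (auto simp: free_iff[OF S] free_iff[OF T])
    finally show ?thesis .
  qed
  show ?thesis unfolding es_le_def using C R D by blast
qed

text \<open>A nonempty cell is leftmost in its row, topmost in its column, or free. The first two
  kinds are fixed by the coordinate functions, so only free cells need comparing.\<close>

lemma fb_eqI:
  assumes S: "fb_tableau n S" and T: "fb_tableau n T"
    and top: "\<And>j. 1 \<le> j \<Longrightarrow> j \<le> n \<Longrightarrow> topmost S j = topmost T j"
    and left: "\<And>i. 1 \<le> i \<Longrightarrow> i \<le> n \<Longrightarrow> leftmost S i = leftmost T i"
    and dots: "\<And>i j. topmost S j < i \<Longrightarrow> j < leftmost S i \<Longrightarrow> (i, j) \<in> S \<longleftrightarrow> (i, j) \<in> T"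
  shows "S = T"
proof -
  have sub: "(i, j) \<in> V"
    if ij: "(i, j) \<in> U" and U: "fb_tableau n U" and V: "fb_tableau n V"
      and "topmost U j = topmost V j" "leftmost U i = leftmost V i"
      and "topmost U j < i \<Longrightarrow> j < leftmost U i \<Longrightarrow> (i, j) \<in> V" for U V i j
  proof -
    consider "j = leftmost U i" | "i = topmost U j" | "topmost U j < i" "j < leftmost U i"
      using le_leftmost[OF U ij] topmost_le[OF ij] by linarith
    then show ?thesis
      using that leftmost_mem[OF V, of i] topmost_mem[OF V, of j] fb_boardD[OF U ij] by cases auto
  qed
  have "(i, j) \<in> S \<longleftrightarrow> (i, j) \<in> T" for i j
  proof
    assume ij: "(i, j) \<in> S"
    note eqs = top[OF fb_boardD(3,4)[OF S ij]] left[OF fb_boardD(1,2)[OF S ij]]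
    show "(i, j) \<in> T" by (rule sub[OF ij S T eqs]) (use dots ij in blast)
  next
    assume ij: "(i, j) \<in> T"
    note eqs = top[OF fb_boardD(3,4)[OF T ij]] left[OF fb_boardD(1,2)[OF T ij]]
    show "(i, j) \<in> S"
      by (rule sub[OF ij T S eqs[symmetric]]) (use dots[of j i] eqs ij in simp)
  qed
  then show ?thesis by auto
qed

section \<open>The three operations behind the moves\<close>

lemma nonempty_iff: "c \<in> T \<longleftrightarrow> content n T c \<noteq> Empty"
  unfolding content_def by auto

text \<open>The cell that the up-arrow leaves is kept exactly when it is a border cell, since border
  cells must be nonempty.\<close>

definition raise_up :: "nat \<Rightarrow> nat \<Rightarrow> nat \<Rightarrow> cell set \<Rightarrow> cell set" where
  "raise_up n i j S =
     insert (i, j) (S - (if (topmost S j, j) \<in> border n then {} else {(topmost S j, j)}))"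

text \<open>Only the old left-arrow is deleted: the dot that it replaces is already in the set and
  becomes the left-arrow by being the new leftmost cell.\<close>

definition push_left :: "nat \<Rightarrow> cell set \<Rightarrow> cell set" where
  "push_left i S = S - {(i, leftmost S i)}"

text \<open>The hypothesis on \<open>leftmost S i\<close> says that the target is not pointed.
  Equality cannot occur, as the cells above an up-arrow are empty; so the new cell is supported from
  the left and changes no \<open>leftmost\<close> value. The deleted cell, an up-arrow, is not
  leftmost either, and whatever it supported in column \<open>j\<close> is now supported by
  \<open>(i, j)\<close>.\<close>

lemma raise_up_arrow:
  assumes S: "fb_tableau n S" and j: "1 \<le> j" "j < n" and i: "1 \<le> i" "i < topmost S j"
    and left: "j \<le> leftmost S i"
  shows "fb_tableau n (raise_up n i j S)" "topmost (raise_up n i j S) j = i"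
    "\<And>k. k \<noteq> j \<Longrightarrow> topmost (raise_up n i j S) k = topmost S k"
    "\<And>r. 1 \<le> r \<Longrightarrow> r \<le> n \<Longrightarrow> leftmost (raise_up n i j S) r = leftmost S r"
    "j < leftmost S (topmost S j)"
proof -
  let ?m = "topmost S j"
  have m: "?m \<le> n" "?m \<le> j + 1" using topmost_bounds[OF S, of j] j by auto
  show lm: "j < leftmost S ?m" using leftmost_topmost[OF S j] .
  have "j \<noteq> leftmost S i"
    using topmost_le[of i j S] leftmost_mem[OF S, of i] i m by force
  then have li: "j < leftmost S i" using left by simp
  have mem: "(r, k) \<in> raise_up n i j S \<longleftrightarrow>
      (r, k) = (i, j) \<or> (r, k) \<in> S \<and> ((r, k) \<noteq> (?m, j) \<or> (?m, j) \<in> border n)" for r k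
    unfolding raise_up_def by auto
  have above: "?m \<le> r" if "(r, j) \<in> S" for r
    using topmost_le[OF that] .
  have lmU: "(r, leftmost S r) \<in> raise_up n i j S" if "1 \<le> r" "r \<le> n" for r
    using leftmost_mem[OF S that] lm by (auto simp: mem)
  show "topmost (raise_up n i j S) j = i"
    using above i by (intro topmost_eqI) (force simp: mem)+
  show "topmost (raise_up n i j S) k = topmost S k" if "k \<noteq> j" for k
    unfolding topmost_def using that by (simp add: mem)
  show "leftmost (raise_up n i j S) r = leftmost S r" if "1 \<le> r" "r \<le> n" for r
    using lmU[OF that] le_leftmost[OF S, of r] left
    by (intro leftmost_eqI) (auto simp: mem)
  show "fb_tableau n (raise_up n i j S)"
  proof (rule fb_tableauI)
    show "raise_up n i j S \<subseteq> board n"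
    proof
      fix c assume "c \<in> raise_up n i j S"
      then show "c \<in> board n"
        using i j m fb_boardD[OF S, of "fst c" "snd c"]
        by (cases c) (auto simp: mem board_iff)
    qed
    show "(1, n) \<in> raise_up n i j S" using fb_root[OF S] j by (auto simp: mem)
    show "(r, r - 1) \<in> raise_up n i j S" if "2 \<le> r" "r \<le> n" for r
      using fb_border[OF S that, of "r - 1"] that by (auto simp: mem border_iff)
    fix r k assume rk: "(r, k) \<in> raise_up n i j S" "(r, k) \<noteq> (1, n)"
    show "(\<exists>l>k. (r, l) \<in> raise_up n i j S) \<or> (\<exists>l<r. (l, k) \<in> raise_up n i j S)"
    proof (cases "(r, k) = (i, j)")
      case True
      then show ?thesis using li lmU[of i] i m by force
    next
      case False
      then have rkS: "(r, k) \<in> S" using rk by (auto simp: mem)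
      note b = fb_boardD[OF S rkS]
      from fb_supported[OF S rkS rk(2)] show ?thesis
      proof
        assume "k < leftmost S r"
        then show ?thesis using lmU[of r] b by blast
      next
        assume top: "topmost S k < r"
        show ?thesis
        proof (cases "k = j")
          case True
          then show ?thesis using top i by (intro disjI2 exI[of _ i]) (auto simp: mem)
        next
          case False
          then show ?thesis using top topmost_mem[OF S, of k] b by (force simp: mem)
        qed
      qed
    qed
  qed
qed

text \<open>By \<open>between\<close>, the cells between the old and the new left-arrow lie above
  the up-arrows of their columns and are empty. An up-arrow among them would lose its support. The
  deleted left-arrow is supported from above, so no \<open>topmost\<close> value changes.\<close>

lemma push_left_arrow:
  assumes S: "fb_tableau n S" and i: "2 \<le> i" and ij: "(i, j) \<in> S"
    and free: "topmost S j < i" "j < leftmost S i"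
    and between: "\<forall>k. j < k \<and> k < leftmost S i \<longrightarrow> i < topmost S k"
  shows "fb_tableau n (push_left i S)" "leftmost (push_left i S) i = j"
    "\<And>r. r \<noteq> i \<Longrightarrow> leftmost (push_left i S) r = leftmost S r"
    "\<And>k. 1 \<le> k \<Longrightarrow> k \<le> n \<Longrightarrow> topmost (push_left i S) k = topmost S k"
proof -
  note b = fb_boardD[OF S ij]
  have mem: "(r, k) \<in> push_left i S \<longleftrightarrow> (r, k) \<in> S \<and> (r, k) \<noteq> (i, leftmost S i)" for r k
    unfolding push_left_def by auto
  have right: "k \<le> j" if "(i, k) \<in> push_left i S" for k
  proof (rule ccontr)
    assume "\<not> k \<le> j"
    moreover have "(i, k) \<in> S" "k < leftmost S i"
      using that le_leftmost[OF S, of i k] by (auto simp: mem)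
    ultimately show False using between[rule_format, of k] topmost_le[of i k S] by simp
  qed
  show "leftmost (push_left i S) i = j"
    using ij free right by (intro leftmost_eqI) (auto simp: mem)
  show "leftmost (push_left i S) r = leftmost S r" if "r \<noteq> i" for r
    unfolding leftmost_def[of _ r] using that by (simp add: mem)
  have topU: "(topmost S k, k) \<in> push_left i S" if "1 \<le> k" "k \<le> n" for k
    using topmost_mem[OF S that] topmost_leftmost[OF S i b(2)] by (auto simp: mem)
  show "topmost (push_left i S) k = topmost S k" if "1 \<le> k" "k \<le> n" for k
    using topU[OF that] topmost_le[of _ k S] by (intro topmost_eqI) (auto simp: mem)
  show "fb_tableau n (push_left i S)"
  proof (rule fb_tableauI)
    show "push_left i S \<subseteq> board n" using S unfolding push_left_def fb_tableau_def by blast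
    show "(1, n) \<in> push_left i S" using fb_root[OF S] i by (auto simp: mem)
    \<comment> \<open>The deleted cell has \<open>(i, j)\<close> to its right, so it is not the
      border cell of row \<open>i\<close>.\<close>
    show "(r, r - 1) \<in> push_left i S" if "2 \<le> r" "r \<le> n" for r
      using fb_border[OF S that, of "r - 1"] that b free by (auto simp: mem)
    fix r k assume rk: "(r, k) \<in> push_left i S" "(r, k) \<noteq> (1, n)"
    then have rkS: "(r, k) \<in> S" by (simp add: mem)
    note b' = fb_boardD[OF S rkS]
    show "(\<exists>l>k. (r, l) \<in> push_left i S) \<or> (\<exists>l<r. (l, k) \<in> push_left i S)"
    proof (cases "topmost S k < r")
      case True
      then show ?thesis using topU[of k] b' by blast
    next
      case False
      then have left: "k < leftmost S r" using fb_supported[OF S rkS rk(2)] by blast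
      show ?thesis
      proof (cases "r = i")
        case True
        \<comment> \<open>Column \<open>k\<close> does not start above row \<open>i\<close>, whereas
          column \<open>j\<close> does. The new left-arrow \<open>(i, j)\<close> then lies to the
          left of \<open>(i, k)\<close> and supports it.\<close>
        then have "k \<noteq> j" using False free by auto
        then have "k < j" using right rk True by force
        then show ?thesis using True ij free by (force simp: mem)
      next
        case False
        then show ?thesis using left leftmost_mem[OF S, of r] b' by (force simp: mem)
      qed
    qed
  qed
qed

lemma insert_dot:
  assumes S: "fb_tableau n S" and ij: "(i, j) \<in> board n"
    and free: "topmost S j < i" "j < leftmost S i"
  shows "fb_tableau n (insert (i, j) S)"
    "\<And>r. 1 \<le> r \<Longrightarrow> r \<le> n \<Longrightarrow> leftmost (insert (i, j) S) r = leftmost S r"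
    "\<And>k. 1 \<le> k \<Longrightarrow> k \<le> n \<Longrightarrow> topmost (insert (i, j) S) k = topmost S k"
proof -
  show "leftmost (insert (i, j) S) r = leftmost S r" if "1 \<le> r" "r \<le> n" for r
    using leftmost_mem[OF S that] le_leftmost[OF S, of r] free by (intro leftmost_eqI) auto
  show "topmost (insert (i, j) S) k = topmost S k" if "1 \<le> k" "k \<le> n" for k
    using topmost_mem[OF S that] topmost_le[of _ k S] free by (intro topmost_eqI) auto
  show "fb_tableau n (insert (i, j) S)"
  proof (rule fb_tableauI)
    show "insert (i, j) S \<subseteq> board n" using S ij unfolding fb_tableau_def by blast
    show "(1, n) \<in> insert (i, j) S" using fb_root[OF S] by simp
    show "(r, r - 1) \<in> insert (i, j) S" if "2 \<le> r" "r \<le> n" for r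
      using fb_border[OF S that, of "r - 1"] that by simp
    fix r k assume "(r, k) \<in> insert (i, j) S" "(r, k) \<noteq> (1, n)"
    then have "(k < leftmost S r \<or> topmost S k < r) \<and> (r, k) \<in> board n"
      using fb_supported[OF S, of r k] free ij fb_boardD[OF S, of r k] by (auto simp: board_iff)
    then show "(\<exists>l>k. (r, l) \<in> insert (i, j) S) \<or> (\<exists>l<r. (l, k) \<in> insert (i, j) S)"
      using leftmost_mem[OF S, of r] topmost_mem[OF S, of k] by (auto simp: board_iff)
  qed
qed

section \<open>The moves in coordinates\<close>

lemma move_I_iff:
  assumes S: "fb_tableau n S" and T: "fb_tableau n T"
  shows "move_I n S T \<longleftrightarrow> (\<exists>i j. 1 \<le> j \<and> j < n \<and> 1 \<le> i \<and> i < topmost S j \<and> j \<le> leftmost S i \<and>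
    (\<forall>r. i < r \<and> r < topmost S j \<longrightarrow> leftmost S r < j) \<and> T = raise_up n i j S)"
    (is "_ \<longleftrightarrow> ?R")
proof
  assume "move_I n S T"
  then obtain u c where u: "content n S u = Up_Arrow" and c: "c \<in> board n" "above c u" "c \<notin> pointed n S"
    and between: "\<And>d. d \<in> board n \<Longrightarrow> above c d \<Longrightarrow> above d u \<Longrightarrow> d \<in> pointed n S"
    and T_eq: "content n T = (content n S)(c := Up_Arrow, u := (if u \<in> border n then Dot else Empty))"
    unfolding move_I_def by blast
  obtain i j where c_eq: "c = (i, j)" by fastforce
  have u_eq: "u = (topmost S j, j)" and j: "1 \<le> j" "j < n"
    using u c(2) up_arrow_iff[OF S, of "fst u" "snd u"] unfolding above_def c_eq by (cases u; auto)+
  have i: "1 \<le> i" "i < topmost S j"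
    using c unfolding c_eq u_eq above_def by (auto simp: board_iff)
  have left: "j \<le> leftmost S i"
    using c(1,3) unfolding c_eq by (simp add: pointed_iff[OF S])
  have "leftmost S r < j" if "i < r \<and> r < topmost S j" for r
  proof -
    have "(r, j) \<in> board n"
      using that i j topmost_bounds[OF S, of j] by (simp add: board_iff)
    then show ?thesis
      using between[of "(r, j)"] that unfolding c_eq u_eq above_def by (simp add: pointed_iff[OF S])
  qed
  moreover have "T = raise_up n i j S"
    using i u unfolding u_eq
    by (intro set_eqI) (auto simp: nonempty_iff[of _ T n] nonempty_iff[of _ S n] T_eq raise_up_def c_eq u_eq)
  ultimately show ?R using i j left by blast
next
  assume ?R
  then obtain i j where j: "1 \<le> j" "j < n" and i: "1 \<le> i" "i < topmost S j" and left: "j \<le> leftmost S i"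
    and between: "\<And>r. i < r \<Longrightarrow> r < topmost S j \<Longrightarrow> leftmost S r < j"
    and T_eq: "T = raise_up n i j S"
    by blast
  let ?m = "topmost S j"
  note T' = raise_up_arrow[OF S j i left, folded T_eq]
  have m: "?m \<le> n" "?m \<le> j + 1" using topmost_bounds[OF S, of j] j by auto
  have ij: "(i, j) \<in> board n" using i j m by (simp add: board_iff)
  have "content n T (a, b) =
    ((content n S)((i, j) := Up_Arrow, (?m, j) := (if (?m, j) \<in> border n then Dot else Empty))) (a, b)"
    for a b
  proof -
    consider "(a, b) = (i, j)" | "(a, b) = (?m, j)" | "(a, b) \<noteq> (i, j)" "(a, b) \<noteq> (?m, j)" by blast
    then show ?thesis
    proof cases
      case 1
      then show ?thesis
        using up_arrow_iff[OF T, of i j] T'(2) i j by simp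
    next
      case 2
      have "(?m, j) \<in> T \<longleftrightarrow> (?m, j) \<in> border n" using i topmost_mem[OF S, of j] j unfolding T_eq raise_up_def by auto
      \<comment> \<open>The up-arrow was not leftmost in its row, so a border cell that it leaves
        shows a dot and not a left-arrow.\<close>
      moreover have "j \<noteq> leftmost T ?m" using T'(4)[of ?m] T'(5) i m by simp
      ultimately show ?thesis
        using 2 content_eq[OF T, of ?m j] T'(2) i j by simp
    next
      case 3
      have mem: "(a, b) \<in> T \<longleftrightarrow> (a, b) \<in> S" unfolding T_eq raise_up_def using 3 by auto
      show ?thesis
      proof (cases "(a, b) \<in> S")
        case True
        have "a = topmost T b \<longleftrightarrow> a = topmost S b" using 3 T'(2,3) by (cases "b = j") auto
        moreover have "leftmost T a = leftmost S a" using T'(4) fb_boardD[OF S True] by blast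
        ultimately have "content n T (a, b) = content n S (a, b)"
          unfolding content_eq[OF T] content_eq[OF S] mem by presburger
        then show ?thesis using 3 by auto
      next
        case False
        then show ?thesis using 3 mem by (simp add: content_def)
      qed
    qed
  qed
  then have "content n T =
    (content n S)((i, j) := Up_Arrow, (?m, j) := (if (?m, j) \<in> border n then Dot else Empty))"
    by auto
  moreover have "content n S (?m, j) = Up_Arrow" using up_arrow_iff[OF S] j by simp
  moreover have "(i, j) \<notin> pointed n S" using left by (simp add: pointed_iff[OF S])
  moreover have "\<forall>d \<in> board n. above (i, j) d \<and> above d (?m, j) \<longrightarrow> d \<in> pointed n S"
    using between unfolding above_def by (auto simp: pointed_iff[OF S])
  moreover have "above (i, j) (?m, j)" using i by (simp add: above_def)
  ultimately show "move_I n S T" unfolding move_I_def using ij by blast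
qed

text \<open>The definition of the move forbids only free cells between the left-arrow and its
  target, while the coordinate form also forbids up-arrows there. These are excluded because the
  result \<open>T\<close> is a tableau.\<close>

lemma move_II_iff:
  assumes S: "fb_tableau n S" and T: "fb_tableau n T"
  shows "move_II n S T \<longleftrightarrow> (\<exists>i j. 2 \<le> i \<and> (i, j) \<in> S \<and> topmost S j < i \<and> j < leftmost S i \<and>
    (\<forall>k. j < k \<and> k < leftmost S i \<longrightarrow> i < topmost S k) \<and> T = push_left i S)"
    (is "_ \<longleftrightarrow> ?R")
proof
  assume "move_II n S T"
  then obtain l c where l: "content n S l = Left_Arrow" and c: "c \<in> free_cells n S" "left_of l c"
    and between: "\<And>d. d \<in> free_cells n S \<Longrightarrow> left_of l d \<Longrightarrow> \<not> left_of d c"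
    and dot: "content n S c = Dot"
    and T_eq: "content n T = (content n S)(c := Left_Arrow, l := Empty)"
    unfolding move_II_def by blast
  obtain i j where c_eq: "c = (i, j)" by fastforce
  have l_eq: "l = (i, leftmost S i)" and i: "2 \<le> i" "i \<le> n"
    using l c(2) left_arrow_iff[OF S, of "fst l" "snd l"] unfolding left_of_def c_eq by (cases l; auto)+
  have free: "(i, j) \<in> board n" "topmost S j < i" "j < leftmost S i"
    using c(1) unfolding c_eq by (simp_all add: free_iff[OF S])
  have ij: "(i, j) \<in> S"
    using dot free unfolding c_eq by (simp add: dot_iff[OF S])
  have leftT: "leftmost T i = j"
    using left_arrow_iff[OF T, of i j] free unfolding T_eq c_eq l_eq by simp
  have "i < topmost S k" if k: "j < k \<and> k < leftmost S i" for k
  proof -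
    have kn: "k < n" using k leftmost_bounds[OF S, of i] i by simp
    have "(i, k) \<in> board n" using free(1) k kn by (simp add: board_iff)
    then have "(i, k) \<notin> free_cells n S \<Longrightarrow> i \<le> topmost S k"
      using k by (simp add: free_iff[OF S])
    then have "i \<le> topmost S k"
      using between[of "(i, k)"] k unfolding c_eq l_eq left_of_def by auto
    \<comment> \<open>An up-arrow at \<open>(i, k)\<close> would survive the move and need a
      nonempty cell to its left, but the leftmost cell of row \<open>i\<close> in \<open>T\<close>
      is \<open>(i, j)\<close>, further right.\<close>
    moreover have "i \<noteq> topmost S k"
    proof
      assume ik: "i = topmost S k"
      then have "content n S (i, k) = Up_Arrow" using up_arrow_iff[OF S, of i k] kn k by simp
      then have "content n T (i, k) = Up_Arrow" using k unfolding T_eq c_eq l_eq by simp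
      then have "k < leftmost T i" using leftmost_topmost[OF T, of k] up_arrow_iff[OF T, of i k] by simp
      then show False using leftT k by simp
    qed
    ultimately show ?thesis by simp
  qed
  moreover have "T = push_left i S"
    using dot unfolding c_eq
    by (intro set_eqI) (auto simp: nonempty_iff[of _ T n] nonempty_iff[of _ S n] T_eq push_left_def c_eq l_eq)
  ultimately show ?R using i ij free by blast
next
  assume ?R
  then obtain i j where i: "2 \<le> i" and ij: "(i, j) \<in> S" and free: "topmost S j < i" "j < leftmost S i"
    and between: "\<forall>k. j < k \<and> k < leftmost S i \<longrightarrow> i < topmost S k"
    and T_eq: "T = push_left i S"
    by blast
  note b = fb_boardD[OF S ij]
  note T' = push_left_arrow[OF S i ij free between, folded T_eq]
  have "content n T (a, d) =
    ((content n S)((i, j) := Left_Arrow, (i, leftmost S i) := Empty)) (a, d)" for a d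
  proof -
    consider "(a, d) = (i, j)" | "(a, d) = (i, leftmost S i)"
      | "(a, d) \<noteq> (i, j)" "(a, d) \<noteq> (i, leftmost S i)" by blast
    then show ?thesis
    proof cases
      case 1
      then show ?thesis
        using left_arrow_iff[OF T, of i j] T'(2) i b free by simp
    next
      case 2
      then show ?thesis using free by (simp add: content_def T_eq push_left_def)
    next
      case 3
      have mem: "(a, d) \<in> T \<longleftrightarrow> (a, d) \<in> S" unfolding T_eq push_left_def using 3 by auto
      show ?thesis
      proof (cases "(a, d) \<in> S")
        case True
        have "d = leftmost T a \<longleftrightarrow> d = leftmost S a" using 3 T'(2,3) by (cases "a = i") auto
        moreover have "topmost T d = topmost S d" using T'(4) fb_boardD[OF S True] by blast
        ultimately have "content n T (a, d) = content n S (a, d)"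
          unfolding content_eq[OF T] content_eq[OF S] mem by presburger
        then show ?thesis using 3 by auto
      next
        case False
        then show ?thesis using 3 mem by (simp add: content_def)
      qed
    qed
  qed
  then have "content n T = (content n S)((i, j) := Left_Arrow, (i, leftmost S i) := Empty)"
    by auto
  moreover have "content n S (i, leftmost S i) = Left_Arrow"
    using left_arrow_iff[OF S] i b by simp
  moreover have "(i, j) \<in> free_cells n S"
    using b free by (simp add: free_iff[OF S] board_iff)
  moreover have "left_of (i, leftmost S i) (i, j)" using free by (simp add: left_of_def)
  moreover have "\<forall>d \<in> free_cells n S. \<not> (left_of (i, leftmost S i) d \<and> left_of d (i, j))"
    using between unfolding left_of_def by (force simp: free_iff[OF S])
  moreover have "content n S (i, j) = Dot" using ij free by (simp add: dot_iff[OF S])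
  ultimately show "move_II n S T" unfolding move_II_def by blast
qed

lemma move_III_iff:
  assumes S: "fb_tableau n S" and T: "fb_tableau n T"
  shows "move_III n S T \<longleftrightarrow> (\<exists>i j. (i, j) \<in> board n \<and> topmost S j < i \<and> j < leftmost S i \<and>
    (i, j) \<notin> S \<and> T = insert (i, j) S)"
    (is "_ \<longleftrightarrow> ?R")
proof
  assume "move_III n S T"
  then obtain i j where ij: "(i, j) \<in> free_cells n S" "content n S (i, j) = Empty"
    and T_eq: "content n T = (content n S)((i, j) := Dot)"
    unfolding move_III_def by force
  have "(i, j) \<notin> S" using ij(2) nonempty_iff by blast
  moreover have "T = insert (i, j) S"
    by (intro set_eqI) (auto simp: nonempty_iff[of _ T n] nonempty_iff[of _ S n] T_eq)
  ultimately show ?R using ij(1) by (auto simp: free_iff[OF S])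
next
  assume ?R
  then obtain i j where ij: "(i, j) \<in> board n" and free: "topmost S j < i" "j < leftmost S i"
    and empty: "(i, j) \<notin> S" and T_eq: "T = insert (i, j) S"
    by blast
  note T' = insert_dot[OF S ij free, folded T_eq]
  have b: "1 \<le> i" "i \<le> n" "1 \<le> j" "j \<le> n" using ij by (auto simp: board_iff)
  have "content n T (a, d) = ((content n S)((i, j) := Dot)) (a, d)" for a d
  proof (cases "(a, d) = (i, j)")
    case True
    then show ?thesis
      using dot_iff[OF T, of j i] T'(2)[of i] T'(3)[of j] free b by (simp add: T_eq)
  next
    case False
    then have mem: "(a, d) \<in> T \<longleftrightarrow> (a, d) \<in> S" unfolding T_eq by auto
    show ?thesis
    proof (cases "(a, d) \<in> S")
      case True
      then have "leftmost T a = leftmost S a" "topmost T d = topmost S d"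
        using T'(2,3) fb_boardD[OF S True] by blast+
      then have "content n T (a, d) = content n S (a, d)"
        unfolding content_eq[OF T] content_eq[OF S] mem by presburger
      then show ?thesis using False by auto
    qed (use False mem in \<open>simp add: content_def\<close>)
  qed
  then have "content n T = (content n S)((i, j) := Dot)" by auto
  moreover have "(i, j) \<in> free_cells n S" using ij free by (simp add: free_iff[OF S])
  moreover have "content n S (i, j) = Empty" using empty by (simp add: content_def)
  ultimately show "move_III n S T" unfolding move_III_def by blast
qed

section \<open>Every move is a cover relation\<close>

text \<open>\<open>S\<close> and \<open>T\<close>, hence any \<open>U\<close> between them, share
  all left-arrows and the up-arrows outside column \<open>j\<close>. In the rows strictly between
  the two positions of the up-arrow the left-arrow lies to the right of column \<open>j\<close>, so
  an up-arrow of \<open>U\<close> there would lack support. Thus \<open>topmost U j\<close> is one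
  of the two end values, and the dots settle the rest.\<close>

lemma move_I_covers:
  assumes S: "fb_tableau n S" and T: "fb_tableau n T" and move: "move_I n S T"
  shows "es_covers n S T"
proof -
  obtain i j where j: "1 \<le> j" "j < n" and i: "1 \<le> i" "i < topmost S j" and left: "j \<le> leftmost S i"
    and gap: "\<And>r. i < r \<Longrightarrow> r < topmost S j \<Longrightarrow> leftmost S r < j"
    and T_eq: "T = raise_up n i j S"
    using move unfolding move_I_iff[OF S T] by blast
  let ?m = "topmost S j"
  note T' = raise_up_arrow[OF S j i left, folded T_eq]
  have mem: "(a, b) \<in> T \<longleftrightarrow>
      (a, b) = (i, j) \<or> (a, b) \<in> S \<and> ((a, b) \<noteq> (?m, j) \<or> (?m, j) \<in> border n)" for a b
    unfolding T_eq raise_up_def by auto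
  have "topmost T k \<le> topmost S k" for k
    using T'(2,3) i by (cases "k = j") auto
  then have "es_le n S T"
    unfolding es_le_iff[OF S T] using T'(4) mem by auto
  moreover have "S \<noteq> T" using T'(2) i by auto
  moreover have "U = S \<or> U = T" if U: "fb_tableau n U" and SU: "es_le n S U" and UT: "es_le n U T" for U
  proof -
    note SU' = SU[unfolded es_le_iff[OF S U]]
    note UT' = UT[unfolded es_le_iff[OF U T]]
    have leftU: "leftmost U r = leftmost S r" if "1 \<le> r" "r \<le> n" for r
      using SU' UT' T'(4)[OF that] that by (metis le_antisym)
    have topU: "topmost U k = topmost S k" if "1 \<le> k" "k \<le> n" "k \<noteq> j" for k
      using SU' UT' T'(3)[OF that(3)] that by (metis le_antisym)
    have "i \<le> topmost U j" "topmost U j \<le> ?m"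
      using SU' UT' T'(2) j by auto
    moreover have "\<not> (i < topmost U j \<and> topmost U j < ?m)"
      using gap[of "topmost U j"] leftmost_topmost[OF U j] leftU[of "topmost U j"] topmost_bounds[OF U, of j] j
      by auto
    ultimately consider "topmost U j = ?m" | "topmost U j = i" by linarith
    then show ?thesis
    proof cases
      case 1
      have "U = S"
      proof (rule fb_eqI[OF U S])
        fix a b assume free: "topmost U b < a" "b < leftmost U a"
        show "(a, b) \<in> U \<longleftrightarrow> (a, b) \<in> S"
        proof
          assume ab: "(a, b) \<in> U"
          then have "(a, b) \<in> T"
            using UT' free leftU T'(4) fb_boardD[OF U ab] by metis
          \<comment> \<open>The only cell of \<open>T\<close> outside \<open>S\<close> lies above
            the up-arrow of \<open>U\<close> in its column, so it is not free in
            \<open>U\<close>.\<close>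
          moreover have "(a, b) \<noteq> (i, j)" using free 1 i by auto
          ultimately show "(a, b) \<in> S" by (auto simp: mem)
        next
          assume ab: "(a, b) \<in> S"
          then show "(a, b) \<in> U"
            using SU' free 1 topU[of b] fb_boardD[OF S ab] by (cases "b = j") auto
        qed
      qed (use leftU topU 1 in \<open>metis\<close>)+
      then show ?thesis ..
    next
      case 2
      have "U = T"
      proof (rule fb_eqI[OF U T])
        fix a b assume free: "topmost U b < a" "b < leftmost U a"
        show "(a, b) \<in> U \<longleftrightarrow> (a, b) \<in> T"
        proof
          assume ab: "(a, b) \<in> U"
          then show "(a, b) \<in> T"
            using UT' free leftU T'(4) fb_boardD[OF U ab] by metis
        next
          assume ab: "(a, b) \<in> T"
          have "(a, b) \<noteq> (i, j)" using free 2 by auto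
          then have abS: "(a, b) \<in> S" and bord: "(a, b) = (?m, j) \<Longrightarrow> (?m, j) \<in> border n"
            using ab by (auto simp: mem)
          note bd = fb_boardD[OF S abS]
          show "(a, b) \<in> U"
          proof (cases "topmost S b < a")
            case True
            then show ?thesis using SU' abS free by blast
          next
            case False
            \<comment> \<open>The cell is the old up-arrow \<open>(?m, j)\<close>, free in
              \<open>U\<close> but not in \<open>S\<close>, so \<open>S \<lhd> U\<close> says
              nothing about it. It is in \<open>T\<close> only as a border cell, and then
              \<open>U\<close> contains it too.\<close>
            then have "a = topmost S b" using topmost_le[OF abS] by simp
            moreover from this have "b = j" using topU[of b] free bd by auto
            ultimately show ?thesis using bord U unfolding fb_tableau_def by blast
          qed
        qed
      next
        fix k assume "1 \<le> k" "k \<le> n"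
        then show "topmost U k = topmost T k" using topU T'(2,3) 2 by metis
      qed (use leftU T'(4) in metis)
      then show ?thesis ..
    qed
  qed
  ultimately show ?thesis unfolding es_covers_def by blast
qed

text \<open>Any \<open>U\<close> between shares all up-arrows and the left-arrows outside row
  \<open>i\<close>. A left-arrow of \<open>U\<close> strictly between the two positions would need
  support from above, but by \<open>gap\<close> those columns start below row
  \<open>i\<close>.\<close>

lemma move_II_covers:
  assumes S: "fb_tableau n S" and T: "fb_tableau n T" and move: "move_II n S T"
  shows "es_covers n S T"
proof -
  obtain i j where i: "2 \<le> i" and ij: "(i, j) \<in> S" and free: "topmost S j < i" "j < leftmost S i"
    and gap: "\<forall>k. j < k \<and> k < leftmost S i \<longrightarrow> i < topmost S k"
    and T_eq: "T = push_left i S"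
    using move unfolding move_II_iff[OF S T] by blast
  note ij_board = fb_boardD[OF S ij]
  note T' = push_left_arrow[OF S i ij free gap, folded T_eq]
  have mem: "(a, b) \<in> T \<longleftrightarrow> (a, b) \<in> S \<and> (a, b) \<noteq> (i, leftmost S i)" for a b
    unfolding T_eq push_left_def by auto
  have "leftmost T r \<le> leftmost S r" for r
    using T'(2,3) free by (cases "r = i") auto
  moreover have "(a, b) \<in> T" if "(a, b) \<in> S" "b < leftmost T a" for a b
    using that T'(2) free by (auto simp: mem)
  ultimately have "es_le n S T"
    unfolding es_le_iff[OF S T] using T'(4) by auto
  moreover have "S \<noteq> T" using T'(2) free by auto
  moreover have "U = S \<or> U = T" if U: "fb_tableau n U" and SU: "es_le n S U" and UT: "es_le n U T" for U
  proof -
    note SU' = SU[unfolded es_le_iff[OF S U]]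
    note UT' = UT[unfolded es_le_iff[OF U T]]
    have topU: "topmost U k = topmost S k" if "1 \<le> k" "k \<le> n" for k
      using SU' UT' T'(4)[OF that] that by (metis le_antisym)
    have leftU: "leftmost U r = leftmost S r" if "1 \<le> r" "r \<le> n" "r \<noteq> i" for r
      using SU' UT' T'(3)[OF that(3)] that by (metis le_antisym)
    have "j \<le> leftmost U i" "leftmost U i \<le> leftmost S i"
      using SU' UT' T'(2) ij_board by auto
    moreover have "\<not> (j < leftmost U i \<and> leftmost U i < leftmost S i)"
      using gap[rule_format, of "leftmost U i"] topmost_leftmost[OF U i ij_board(2)] topU[of "leftmost U i"]
        leftmost_bounds[OF U ij_board(1,2)] by auto
    ultimately consider "leftmost U i = leftmost S i" | "leftmost U i = j" by linarith
    then show ?thesis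
    proof cases
      case 1
      have "U = S"
      proof (rule fb_eqI[OF U S])
        fix a b assume freeU: "topmost U b < a" "b < leftmost U a"
        show "(a, b) \<in> U \<longleftrightarrow> (a, b) \<in> S"
        proof
          assume ab: "(a, b) \<in> U"
          note bd = fb_boardD[OF U ab]
          show "(a, b) \<in> S"
          \<comment> \<open>A cell that is still free in \<open>T\<close> keeps its dot there, and
            \<open>T\<close> is contained in \<open>S\<close>. Otherwise the cell is in row
            \<open>i\<close> with \<open>j \<le> b\<close>, and \<open>gap\<close> leaves only
            \<open>(i, j)\<close>, which holds a dot in \<open>S\<close>.\<close>
          proof (cases "b < leftmost T a")
            case True
            then show ?thesis using UT' freeU ab by (auto simp: mem)
          next
            case False
            have "a = i"
            proof (rule ccontr)
              assume "a \<noteq> i"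
              then show False using False freeU leftU[of a] T'(3)[of a] bd by simp
            qed
            then have "\<not> j < b" using gap[rule_format, of b] freeU 1 topU[of b] bd by auto
            then have "(a, b) = (i, j)" using False T'(2) \<open>a = i\<close> by simp
            then show ?thesis using ij by simp
          qed
        next
          assume ab: "(a, b) \<in> S"
          then show "(a, b) \<in> U"
            using SU' freeU topU[of b] fb_boardD[OF S ab] by auto
        qed
      qed (use leftU topU 1 in \<open>metis\<close>)+
      then show ?thesis ..
    next
      case 2
      have leftU': "leftmost U r = leftmost T r" if "1 \<le> r" "r \<le> n" for r
        using leftU[OF that] 2 T'(2,3) by (cases "r = i") auto
      have "U = T"
      proof (rule fb_eqI[OF U T])
        fix a b assume freeU: "topmost U b < a" "b < leftmost U a"
        show "(a, b) \<in> U \<longleftrightarrow> (a, b) \<in> T"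
        proof
          assume ab: "(a, b) \<in> U"
          then show "(a, b) \<in> T"
            using UT' freeU leftU'[of a] fb_boardD[OF U ab] by auto
        next
          assume ab: "(a, b) \<in> T"
          then show "(a, b) \<in> U"
            using SU' freeU topU[of b] fb_boardD[OF T ab] by (auto simp: mem)
        qed
      next
        fix k assume "1 \<le> k" "k \<le> n"
        then show "topmost U k = topmost T k" using topU T'(4) by metis
      qed (use leftU' in blast)
      then show ?thesis ..
    qed
  qed
  ultimately show ?thesis unfolding es_covers_def by blast
qed

text \<open>All arrows of an intermediate tableau are those of \<open>S\<close>, and its dots lie
  between the dots of \<open>S\<close> and those of \<open>T\<close>, which differ in one
  cell.\<close>

lemma move_III_covers:
  assumes S: "fb_tableau n S" and T: "fb_tableau n T" and move: "move_III n S T"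
  shows "es_covers n S T"
proof -
  obtain i j where ij: "(i, j) \<in> board n" and free: "topmost S j < i" "j < leftmost S i"
    and empty: "(i, j) \<notin> S" and T_eq: "T = insert (i, j) S"
    using move unfolding move_III_iff[OF S T] by blast
  note T' = insert_dot[OF S ij free, folded T_eq]
  have "es_le n S T"
    unfolding es_le_iff[OF S T] using T'(2,3) by (auto simp: T_eq)
  moreover have "S \<noteq> T" using empty T_eq by blast
  moreover have "U = S \<or> U = T" if U: "fb_tableau n U" and SU: "es_le n S U" and UT: "es_le n U T" for U
  proof -
    note SU' = SU[unfolded es_le_iff[OF S U]]
    note UT' = UT[unfolded es_le_iff[OF U T]]
    have topU: "topmost U k = topmost S k" if "1 \<le> k" "k \<le> n" for k
      using SU' UT' T'(3)[OF that] that by (metis le_antisym)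
    have leftU: "leftmost U r = leftmost S r" if "1 \<le> r" "r \<le> n" for r
      using SU' UT' T'(2)[OF that] that by (metis le_antisym)
    have dotsU: "((a, b) \<in> S \<longrightarrow> (a, b) \<in> U) \<and> ((a, b) \<in> U \<longrightarrow> (a, b) \<in> T)"
      if fr: "topmost U b < a" "b < leftmost U a" for a b
    proof (intro conjI impI)
      assume ab: "(a, b) \<in> S"
      then show "(a, b) \<in> U" using SU' fr topU[OF fb_boardD(3,4)[OF S ab]] by auto
    next
      assume ab: "(a, b) \<in> U"
      note bd = fb_boardD[OF U ab]
      show "(a, b) \<in> T" using UT' fr ab leftU[OF bd(1,2)] T'(2)[OF bd(1,2)] by auto
    qed
    show ?thesis
    proof (cases "(i, j) \<in> U")
      case True
      have "U = T"
        using topU leftU T'(2,3) dotsU True T_eq by (intro fb_eqI[OF U T]) (metis insert_iff)+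
      then show ?thesis ..
    next
      case False
      have "U = S"
        using topU leftU dotsU False T_eq by (intro fb_eqI[OF U S]) (metis insert_iff)+
      then show ?thesis ..
    qed
  qed
  ultimately show ?thesis unfolding es_covers_def by blast
qed

section \<open>A move from \<open>S\<close> that stays below \<open>T\<close>\<close>

text \<open>If \<open>T\<close> covers \<open>S\<close>, the tableau found here can only be
  \<open>T\<close>, so the cover is a move. The cases treat up-arrows, left-arrows and dots in this
  order, each later one assuming agreement in the earlier ones.\<close>

lemma exists_move_below:
  assumes S: "fb_tableau n S" and T: "fb_tableau n T" and le: "es_le n S T" and neq: "S \<noteq> T"
  shows "\<exists>U. fb_tableau n U \<and> (move_I n S U \<or> move_II n S U \<or> move_III n S U) \<and> es_le n U T"
proof -
  note le' = le[unfolded es_le_iff[OF S T]]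
  \<comment> \<open>Serves two cases: \<open>below\<close> is vacuous when the left-arrow of
    \<open>T\<close> is at or to the right of column \<open>j\<close>, and holds by membership when
    all arrows agree.\<close>
  have insert: ?thesis
    if ij: "(i, j) \<in> board n" and free: "topmost S j < i" "j < leftmost S i" and empty: "(i, j) \<notin> S"
      and below: "j < leftmost T i \<Longrightarrow> (i, j) \<in> T" for i j
  proof -
    let ?U = "insert (i, j) S"
    note U' = insert_dot[OF S ij free]
    have "move_III n S ?U" unfolding move_III_iff[OF S U'(1)] using ij free empty by blast
    moreover have "(a, b) \<in> T" if "(a, b) \<in> ?U" "topmost ?U b < a" "b < leftmost T a" for a b
    proof (cases "(a, b) = (i, j)")
      case False
      then have ab: "(a, b) \<in> S" using that by auto
      then show ?thesis using le' that U'(3)[OF fb_boardD(3,4)[OF S ab]] by auto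
    qed (use that below in simp)
    then have "es_le n ?U T"
      unfolding es_le_iff[OF U'(1) T] using le' U'(2,3) by auto
    ultimately show ?thesis using U'(1) by blast
  qed
  consider (up) j where "1 \<le> j" "j \<le> n" "topmost T j \<noteq> topmost S j"
    | (left) i where "\<forall>j. 1 \<le> j \<and> j \<le> n \<longrightarrow> topmost T j = topmost S j"
        "1 \<le> i" "i \<le> n" "leftmost T i \<noteq> leftmost S i"
    | (dot) "\<forall>j. 1 \<le> j \<and> j \<le> n \<longrightarrow> topmost T j = topmost S j"
        "\<forall>i. 1 \<le> i \<and> i \<le> n \<longrightarrow> leftmost T i = leftmost S i"
    by blast
  then show ?thesis
  proof cases
    case (up j)
    then have lt: "topmost T j < topmost S j" using le' by (simp add: le_neq_implies_less)
    have jn: "j < n" using up topmost_n[OF S] topmost_n[OF T] by (cases "j = n") auto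
    let ?P = "\<lambda>i. 1 \<le> i \<and> i < topmost S j \<and> j \<le> leftmost S i"
    \<comment> \<open>The up-arrow of \<open>T\<close> is supported from the left in
      \<open>T\<close>, and \<open>leftmost S\<close> is at least \<open>leftmost T\<close>. So its
      row is a candidate, and raising to the greatest candidate does not overshoot
      \<open>T\<close>.\<close>
    have PT: "?P (topmost T j)"
      using lt leftmost_topmost[OF T up(1) jn] topmost_bounds[OF T up(1,2)] le'
      by (auto intro: less_imp_le less_le_trans)
    \<comment> \<open>Rows are numbered from the top, so the greatest candidate is the closest cell
      above the up-arrow that is not pointed.\<close>
    define i where "i = (GREATEST i. ?P i)"
    have Pi: "?P i" and ge: "\<And>r. ?P r \<Longrightarrow> r \<le> i"
      unfolding i_def
      by (rule GreatestI_nat[where P = ?P and b = "topmost S j", OF PT]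
          Greatest_le_nat[where P = ?P and b = "topmost S j"]; simp)+
    let ?U = "raise_up n i j S"
    have i: "1 \<le> i" "i < topmost S j" "j \<le> leftmost S i" using Pi by auto
    note U' = raise_up_arrow[OF S up(1) jn i]
    have gap: "leftmost S r < j" if "i < r \<and> r < topmost S j" for r
      using ge[of r] that i by force
    have "move_I n S ?U" unfolding move_I_iff[OF S U'(1)] using up(1) jn i gap by blast
    moreover have "es_le n ?U T"
      unfolding es_le_iff[OF U'(1) T]
    proof (intro conjI allI impI)
      fix k assume k: "1 \<le> k \<and> k \<le> n"
      show "topmost T k \<le> topmost ?U k"
        using k le' U'(2,3) ge[OF PT] by (cases "k = j") auto
    next
      fix r assume r: "1 \<le> r \<and> r \<le> n"
      then show "leftmost T r \<le> leftmost ?U r" using le' U'(4) by auto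
    next
      fix a b assume ab: "(a, b) \<in> ?U \<and> topmost ?U b < a \<and> b < leftmost T a"
      then have "(a, b) \<noteq> (i, j)" using U'(2) by auto
      then have abS: "(a, b) \<in> S" and bord: "(a, b) = (topmost S j, j) \<Longrightarrow> (topmost S j, j) \<in> border n"
        using ab unfolding raise_up_def by (auto split: if_splits)
      show "(a, b) \<in> T"
      proof (cases "topmost S b < a")
        case True
        then show ?thesis using le' abS ab by blast
      next
        case False
        \<comment> \<open>This is the cell the up-arrow has left; it remains only if it is a border
          cell, and \<open>T\<close> contains all border cells.\<close>
        then have "a = topmost S b" using topmost_le[OF abS] by simp
        moreover from this have "b = j" using U'(3)[of b] ab by auto
        ultimately show ?thesis using bord T unfolding fb_tableau_def by blast
      qed
    qed
    ultimately show ?thesis using U'(1) by blast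
  next
    case (left i)
    note top = left(1)
    have lt: "leftmost T i < leftmost S i" using left le' by (simp add: le_neq_implies_less)
    have i: "2 \<le> i"
      using left(2,4) leftmost_1[OF S] leftmost_1[OF T] by (cases "i = 1") auto
    let ?P = "\<lambda>j. (i, j) \<in> board n \<and> topmost S j < i \<and> j < leftmost S i"
    \<comment> \<open>The left-arrow of \<open>T\<close> is supported from above; as the up-arrows
      agree, it occupies a free cell of \<open>S\<close>.\<close>
    have PT: "?P (leftmost T i)"
      using lt i topmost_leftmost[OF T i left(3)] top leftmost_bounds[OF T left(2,3)] left(3)
      by (auto simp: board_iff)
    \<comment> \<open>The greatest label gives the first free cell to the right of the
      left-arrow.\<close>
    define j where "j = (GREATEST j. ?P j)"
    have Pj: "?P j" and ge: "\<And>k. ?P k \<Longrightarrow> k \<le> j"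
      unfolding j_def
      by (rule GreatestI_nat[where P = ?P and b = "leftmost S i", OF PT]
          Greatest_le_nat[where P = ?P and b = "leftmost S i"]; simp)+
    then have ij: "(i, j) \<in> board n" and free: "topmost S j < i" "j < leftmost S i" by auto
    have Tj: "leftmost T i \<le> j" using ge[OF PT] .
    show ?thesis
    proof (cases "(i, j) \<in> S")
      \<comment> \<open>A type II move needs a dot at its target, so the dot is inserted first. This
        is harmless, as \<open>(i, j)\<close> is not free in \<open>T\<close>.\<close>
      case False
      then show ?thesis using insert[OF ij free] Tj by simp
    next
      case True
      have gap: "\<forall>k. j < k \<and> k < leftmost S i \<longrightarrow> i < topmost S k"
      proof (intro allI impI)
        fix k assume k: "j < k \<and> k < leftmost S i"
        have kn: "k < n" using k leftmost_bounds[OF S left(2,3)] by simp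
        then have "(i, k) \<in> board n" using ij k by (simp add: board_iff)
        then have "i \<le> topmost S k" using ge[of k] k by force
        \<comment> \<open>An up-arrow of \<open>S\<close> at \<open>(i, k)\<close> would be one of
          \<open>T\<close> as well, forcing \<open>k < leftmost T i \<le> j\<close>. Here the
          agreement of the up-arrows is essential.\<close>
        moreover have "i \<noteq> topmost S k"
          using leftmost_topmost[OF T, of k] top kn k Tj ij by (auto simp: board_iff)
        ultimately show "i < topmost S k" by simp
      qed
      let ?U = "push_left i S"
      note U' = push_left_arrow[OF S i True free gap]
      have "move_II n S ?U"
        unfolding move_II_iff[OF S U'(1)] using i True free gap by blast
      moreover have "leftmost T r \<le> leftmost ?U r" if "1 \<le> r" "r \<le> n" for r
        using that U'(2,3) le' Tj by (cases "r = i") auto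
      moreover have "(a, b) \<in> T" if "(a, b) \<in> ?U" "topmost ?U b < a" "b < leftmost T a" for a b
      proof -
        have ab: "(a, b) \<in> S" using that unfolding push_left_def by simp
        then show ?thesis using that le' U'(4)[OF fb_boardD(3,4)[OF S ab]] by auto
      qed
      ultimately show ?thesis
        using U'(1,4) top by (auto simp: es_le_iff[OF U'(1) T])
    qed
  next
    case dot
    \<comment> \<open>With all arrows equal, some free cell differs. Dots of \<open>S\<close>
      persist in \<open>T\<close>, so this cell is empty in \<open>S\<close> and filled in
      \<open>T\<close>.\<close>
    have "\<exists>i j. topmost S j < i \<and> j < leftmost S i \<and> ((i, j) \<in> S \<longleftrightarrow> (i, j) \<notin> T)"
      using fb_eqI[OF S T] dot neq by metis
    then obtain i j where free: "topmost S j < i" "j < leftmost S i" and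
      diff: "(i, j) \<in> S \<longleftrightarrow> (i, j) \<notin> T" by blast
    have "(i, j) \<notin> S"
    proof
      assume ij: "(i, j) \<in> S"
      then have "j < leftmost T i" using free dot(2) fb_boardD(1,2)[OF S ij] by simp
      then show False using le' ij free diff by blast
    qed
    moreover from this have "(i, j) \<in> T" using diff by simp
    moreover from this have "(i, j) \<in> board n" using T unfolding fb_tableau_def by blast
    ultimately show ?thesis using insert free by blast
  qed
qed

theorem theorem4p4:
  fixes n :: nat and S T :: "cell set"
  assumes "n > 0" and "fb_tableau n S" and "fb_tableau n T"
  shows "es_covers n S T \<longleftrightarrow> move_I n S T \<or> move_II n S T \<or> move_III n S T"
proof
  assume cov: "es_covers n S T"
  then have "es_le n S T" "S \<noteq> T" unfolding es_covers_def by auto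
  then obtain U where U: "fb_tableau n U" "move_I n S U \<or> move_II n S U \<or> move_III n S U" "es_le n U T"
    using exists_move_below[OF assms(2,3)] by blast
  \<comment> \<open>That moves are covers is used here to obtain \<open>S \<noteq> U\<close>; then
    \<open>U\<close>, weakly below \<open>T\<close>, must equal \<open>T\<close>.\<close>
  then have "es_covers n S U"
    using assms(2) move_I_covers move_II_covers move_III_covers by blast
  then have "U = T"
    using cov U(1,3) unfolding es_covers_def by blast
  then show "move_I n S T \<or> move_II n S T \<or> move_III n S T" using U(2) by simp
qed (use assms move_I_covers move_II_covers move_III_covers in blast)

end
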